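(* Let $R$ be a p.q.-Baer $*$-ring. Then $R$ is a pseudo lattice with respect to Conrad's partial order; that is, whenever $a,b\in R$ have a common upper bound with respect to $\leq$, both $a\wedge b$ and $a\vee b$ exist in $(R,\leq)$.
   Context: A $*$-ring is an (associative) ring $R$ with an involution $x\mapsto x^*$, i.e. an additive anti-automorphism with $(x^* )^*=x$. A projection is an element $e\in R$ with $e=e^2=e^*$. A $*$-ring $R$ is a p.q.-Baer $*$-ring if for every $a\in R$ there is a projection $e\in R$ with $r_R(aR)=eR$, where $r_R(B)=\{x\in R : bx=0 \text{ for every } b\in B\}$. (Such a ring automatically has an identity element and is semiprime.) Conrad's partial order on $R$: $a\leq b$ if and only if $arb=ara$ for all $r\in R$; this is a partial order on every p.q.-Baer $*$-ring. For elements of a poset, $a\vee b=\sup\{a,b\}$ and $a\wedge b=\inf\{a,b\}$. A poset $P$ is a pseudo lattice if for all $a,b\in P$, whenever $a,b$ have a common upper bound, then $a\wedge b$ and $a\vee b$ both exist. *)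

theory Defs
  imports Main
begin

section \<open>Rings with involution\<close>

text \<open>
  The class \<^class>\<open>ring\<close> consists of associative rings that need not have an identity;
  the zero ring is included.
\<close>

locale star_ring =
  fixes star :: "'a::ring \<Rightarrow> 'a"
  assumes star_add: "star (x + y) = star x + star y"
    and star_mult: "star (x * y) = star y * star x"
    and star_star: "star (star x) = x"
begin

definition projection :: "'a \<Rightarrow> bool" where
  "projection e \<longleftrightarrow> e = e * e \<and> e = star e"

end

definition right_annihilator :: "'a::ring set \<Rightarrow> 'a set" where
  "right_annihilator B = {x. \<forall>b\<in>B. b * x = 0}"

definition right_multiples :: "'a::ring \<Rightarrow> 'a set" where
  "right_multiples a = {a * r | r. True}"

locale pq_baer_star_ring = star_ring star for star :: "'a::ring \<Rightarrow> 'a" +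
  assumes pq_baer:
    "\<exists>e. projection e \<and> right_annihilator (right_multiples a) = right_multiples e"


section \<open>Conrad's order and pseudo lattices\<close>

definition conrad_le :: "'a::ring \<Rightarrow> 'a \<Rightarrow> bool" where
  "conrad_le a b \<longleftrightarrow> (\<forall>r. a * r * b = a * r * a)"

text \<open>
  Conrad's relation is in general not the order of an order class instance on the ring, so
  suprema and infima of pairs are taken relative to an explicit relation on the whole type.
\<close>

definition is_sup :: "('a \<Rightarrow> 'a \<Rightarrow> bool) \<Rightarrow> 'a \<Rightarrow> 'a \<Rightarrow> 'a \<Rightarrow> bool" where
  "is_sup le a b s \<longleftrightarrow> le a s \<and> le b s \<and> (\<forall>u. le a u \<and> le b u \<longrightarrow> le s u)"

definition is_inf :: "('a \<Rightarrow> 'a \<Rightarrow> bool) \<Rightarrow> 'a \<Rightarrow> 'a \<Rightarrow> 'a \<Rightarrow> bool" where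
  "is_inf le a b i \<longleftrightarrow> le i a \<and> le i b \<and> (\<forall>l. le l a \<and> le l b \<longrightarrow> le l i)"

definition pseudo_lattice :: "('a \<Rightarrow> 'a \<Rightarrow> bool) \<Rightarrow> bool" where
  "pseudo_lattice le \<longleftrightarrow>
     reflp le \<and> antisymp le \<and> transp le \<and>
     (\<forall>a b. (\<exists>u. le a u \<and> le b u) \<longrightarrow> (\<exists>i. is_inf le a b i) \<and> (\<exists>s. is_sup le a b s))"

end

theory Submission
  imports Defs
begin

text \<open>
  The annihilator \<open>eR\<close> of \<open>aR\<close> is a two-sided ideal, so \<open>e\<close> is central, and with
  \<open>h = 1 - e\<close> one has \<open>a \<le> b\<close> iff \<open>a = h b\<close>. Hence the elements below \<open>u\<close> are
  the \<open>k u\<close> with \<open>k\<close> a central idempotent. If \<open>a = h u\<close> and \<open>b = k u\<close>, then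
  \<open>h k u\<close> is the infimum and \<open>(h + k - h k) u\<close> the supremum of \<open>a\<close> and \<open>b\<close>; the latter
  equals \<open>a + b - h b\<close>, and since \<open>h\<close> can be chosen to depend on \<open>a\<close> alone, it does
  not depend on the upper bound \<open>u\<close>.
\<close>

definition central_idempotent :: "'a::ring \<Rightarrow> bool" where
  "central_idempotent h \<longleftrightarrow> h * h = h \<and> (\<forall>x. h * x = x * h)"

lemma central_idempotent_idem: "central_idempotent h \<Longrightarrow> h * h = h"
  unfolding central_idempotent_def by blast

lemma central_idempotent_commute: "central_idempotent h \<Longrightarrow> h * x = x * h"
  unfolding central_idempotent_def by blast

lemma central_idempotent_left_idem:
  "central_idempotent h \<Longrightarrow> h * (h * x) = h * x"
  by (metis central_idempotent_idem mult.assoc)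

lemma central_idempotent_left_commute:
  "central_idempotent h \<Longrightarrow> h * (x * y) = x * (h * y)"
  by (metis central_idempotent_commute mult.assoc)

lemma central_idempotent_mult:
  assumes "central_idempotent h" "central_idempotent k"
  shows "central_idempotent (h * k)"
proof -
  have "h * k * (h * k) = h * k"
    using central_idempotent_left_commute[OF assms(2), of h k]
    by (simp add: mult.assoc central_idempotent_idem[OF assms(2)]
        central_idempotent_left_idem[OF assms(1)])
  moreover have "h * k * x = x * (h * k)" for x
    by (metis assms central_idempotent_commute mult.assoc)
  ultimately show ?thesis
    unfolding central_idempotent_def by blast
qed

text \<open>In a unital ring this element is \<open>1 - (1 - h) * (1 - k)\<close>; the class
  \<open>ring\<close> provides no \<open>1\<close>, so the verification expands the
  products.\<close>

lemma central_idempotent_join: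
  assumes h: "central_idempotent h" and k: "central_idempotent k"
  shows "central_idempotent (h + k - h * k)"
proof -
  have "(h + k - h * k) * x = x * (h + k - h * k)" for x
    using central_idempotent_commute[OF h, of x] central_idempotent_commute[OF k, of x]
      central_idempotent_commute[OF central_idempotent_mult[OF h k], of x]
    by (simp add: distrib_left distrib_right left_diff_distrib right_diff_distrib)
  moreover have "(h + k - h * k) * (h + k - h * k) = h + k - h * k"
    using central_idempotent_commute[OF k, of h]
    by (simp add: algebra_simps central_idempotent_idem[OF h] central_idempotent_idem[OF k]
        central_idempotent_left_idem[OF h] central_idempotent_left_idem[OF k]
        central_idempotent_left_commute[OF k, of h])
  ultimately show ?thesis
    unfolding central_idempotent_def by blast
qed

lemma conrad_le_refl: "conrad_le a a"
  by (simp add: conrad_le_def)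

text \<open>Centrality moves the second \<open>h\<close> to the front, where idempotence absorbs
  it.\<close>

lemma conrad_le_central_idempotent_mult:
  assumes "central_idempotent h"
  shows "conrad_le (h * b) b"
proof -
  have "h * b * r * (h * b) = h * b * r * b" for r
    using central_idempotent_left_commute[OF assms, of "b * r" b]
      central_idempotent_left_idem[OF assms, of "b * r * b"]
    by (metis mult.assoc)
  then show ?thesis
    by (simp add: conrad_le_def)
qed

context pq_baer_star_ring
begin

lemma mem_right_multiples_projection:
  assumes "projection e"
  shows "x \<in> right_multiples e \<longleftrightarrow> e * x = x"
proof -
  have "e * e = e"
    using assms by (simp add: projection_def)
  then show ?thesis
    unfolding right_multiples_def mem_Collect_eq by (metis mult.assoc)
qed

text \<open>Everything annihilates \<open>0\<close>, so the projection \<open>e\<close> attached to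
  \<open>0\<close> fixes every element from the left; applying \<open>star\<close> makes it a right
  identity too.\<close>

lemma identity_exists: "\<exists>i::'a. \<forall>x. i * x = x \<and> x * i = x"
proof -
  obtain e where e: "projection e"
    and eR: "right_annihilator (right_multiples 0) = right_multiples e"
    using pq_baer by blast
  have left: "e * x = x" for x
    unfolding mem_right_multiples_projection[OF e, symmetric] eR[symmetric]
    by (auto simp: right_annihilator_def right_multiples_def)
  have "x * e = x" for x
    using left[of "star x"] e star_star star_mult unfolding projection_def by metis
  with left show ?thesis by blast
qed

text \<open>The hypothesis gives \<open>e * y * e = y * e\<close> for all \<open>y\<close>. Applying
  \<open>star\<close> to the case \<open>y = star x\<close> yields \<open>e * x * e = e * x\<close>,
  and the two combine.\<close>

lemma projection_central:
  assumes e: "projection e" and ideal: "\<And>x. x * e \<in> right_multiples e"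
  shows "e * x = x * e"
proof -
  have *: "e * (y * e) = y * e" for y
    using ideal[of y] mem_right_multiples_projection[OF e] by blast
  have "star (e * (star x * e)) = star (star x * e)"
    by (simp only: *)
  then have "e * x * e = e * x"
    using e by (simp add: star_mult star_star projection_def)
  then show ?thesis using *[of x] by (simp add: mult.assoc)
qed

lemma central_cover_exists:
  fixes a :: 'a
  shows "\<exists>h. central_idempotent h \<and> (\<forall>b. conrad_le a b \<longleftrightarrow> a = h * b)"
proof -
  obtain i :: 'a where i: "\<And>x. i * x = x" "\<And>x. x * i = x"
    using identity_exists by blast
  obtain e where e: "projection e"
    and eR: "right_annihilator (right_multiples a) = right_multiples e"
    using pq_baer by blast
  have ee: "e * e = e"
    using e by (simp add: projection_def)
  have mem: "x \<in> right_multiples e \<longleftrightarrow> (\<forall>r. a * r * x = 0)" for x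
    unfolding eR[symmetric] by (auto simp: right_annihilator_def right_multiples_def)
  note mem' = mem_right_multiples_projection[OF e]
  have ae: "a * r * e = 0" for r
    using mem mem' ee by blast
  \<comment> \<open>\<open>x * e\<close> lies in the annihilator because
    \<open>a * r * (x * e) = a * (r * x) * e = 0\<close>.\<close>
  have central: "e * x = x * e" for x
    by (rule projection_central[OF e]) (metis mem ae mult.assoc)
  have ea: "e * a = 0"
    using ae[of i] central[of a] by (simp add: i)
  have "(i - e) * x = x * (i - e)" for x
    using central[of x] by (simp add: left_diff_distrib right_diff_distrib i)
  moreover have "(i - e) * (i - e) = i - e"
    by (simp add: left_diff_distrib right_diff_distrib i ee)
  ultimately have h: "central_idempotent (i - e)"
    unfolding central_idempotent_def by blast
  have "conrad_le a b \<longleftrightarrow> a = (i - e) * b" for b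
  proof -
    \<comment> \<open>The order says \<open>a * r * (b - a) = 0\<close> for all \<open>r\<close>.
      Membership then reads \<open>e * (b - a) = b - a\<close>, which \<open>ea\<close> turns into
      \<open>a = b - e * b\<close>.\<close>
    have "conrad_le a b \<longleftrightarrow> b - a \<in> right_multiples e"
      unfolding mem conrad_le_def by (simp add: right_diff_distrib)
    also have "\<dots> \<longleftrightarrow> a = (i - e) * b"
      unfolding mem' by (auto simp: left_diff_distrib right_diff_distrib i ea algebra_simps)
    finally show ?thesis .
  qed
  with h show ?thesis by blast
qed

lemma conrad_le_iff:
  fixes a b :: 'a
  shows "conrad_le a b \<longleftrightarrow> (\<exists>h. central_idempotent h \<and> a = h * b)"
  using central_cover_exists conrad_le_central_idempotent_mult by blast

text \<open>If \<open>a = h * b\<close> and \<open>b = k * a\<close>, then \<open>h * a = a\<close>,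
  so \<open>a = h * k * a = k * h * a = k * a = b\<close>.\<close>

lemma conrad_le_antisym:
  fixes a b :: 'a
  assumes "conrad_le a b" "conrad_le b a"
  shows "a = b"
  by (metis assms conrad_le_iff central_idempotent_left_idem central_idempotent_left_commute)

lemma conrad_le_trans:
  fixes a b c :: 'a
  assumes "conrad_le a b" "conrad_le b c"
  shows "conrad_le a c"
  by (metis assms conrad_le_iff central_idempotent_mult mult.assoc)

lemma conrad_inf_exists:
  fixes a b u :: 'a
  assumes au: "conrad_le a u" and bu: "conrad_le b u"
  shows "\<exists>i. is_inf conrad_le a b i"
proof -
  obtain h where h: "central_idempotent h" and a: "a = h * u"
    using au conrad_le_iff by blast
  obtain k where k: "central_idempotent k" and b: "b = k * u"
    using bu conrad_le_iff by blast
  have ka: "h * (k * u) = k * a"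
    unfolding a by (rule central_idempotent_left_commute[OF h])
  have "conrad_le l (h * (k * u))" if la: "conrad_le l a" and lb: "conrad_le l b" for l
  proof -
    \<comment> \<open>A single \<open>m\<close>, depending on \<open>l\<close> alone, serves both
      bounds. It remains to see \<open>m * (h * b) = l\<close>, which follows from
      \<open>h * l = l\<close>, a consequence of \<open>h * a = a\<close>.\<close>
    obtain m where m: "central_idempotent m" and m_iff: "\<And>b. conrad_le l b \<longleftrightarrow> l = m * b"
      using central_cover_exists by blast
    have ml: "l = m * a" "l = m * b"
      using la lb m_iff by auto
    have "m * (h * b) = h * l"
      using ml(2) central_idempotent_left_commute[OF m] by metis
    also have "\<dots> = l"
      using ml(1) a central_idempotent_left_commute[OF m] central_idempotent_left_idem[OF h]
      by metis
    finally show ?thesis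
      unfolding m_iff b by simp
  qed
  moreover have "conrad_le (h * (k * u)) a"
    unfolding ka by (rule conrad_le_central_idempotent_mult[OF k])
  moreover have "conrad_le (h * (k * u)) b"
    unfolding b by (rule conrad_le_central_idempotent_mult[OF h])
  ultimately show ?thesis
    unfolding is_inf_def by blast
qed

lemma conrad_sup_exists:
  fixes a b u :: 'a
  assumes au: "conrad_le a u" and bu: "conrad_le b u"
  shows "\<exists>s. is_sup conrad_le a b s"
proof -
  obtain h where h: "central_idempotent h" and h_iff: "\<And>v. conrad_le a v \<longleftrightarrow> a = h * v"
    using central_cover_exists by blast
  obtain k where k: "central_idempotent k" and k_iff: "\<And>v. conrad_le b v \<longleftrightarrow> b = k * v"
    using central_cover_exists by blast
  let ?s = "a + b - h * b"
  have a: "a = h * u" and b: "b = k * u"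
    using au bu h_iff k_iff by auto
  have "a = h * ?s"
    unfolding a by (simp add: algebra_simps central_idempotent_left_idem[OF h])
  \<comment> \<open>The common upper bound \<open>u\<close> enters here: \<open>k * a\<close> and
    \<open>h * b\<close> both equal \<open>h * k * u\<close>, so they cancel.\<close>
  moreover have "b = k * ?s"
    unfolding a b
    by (simp add: algebra_simps central_idempotent_left_idem[OF k]
        central_idempotent_left_commute[OF k, of h])
  moreover have "conrad_le ?s v" if av: "conrad_le a v" and bv: "conrad_le b v" for v
  proof -
    have "a = h * v" "b = k * v"
      using av bv h_iff k_iff by auto
    \<comment> \<open>The same \<open>h\<close> and \<open>k\<close> work for every upper bound
      \<open>v\<close>, so \<open>?s\<close> is a central idempotent multiple of each.\<close>
    then have "?s = (h + k - h * k) * v"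
      by (simp add: algebra_simps)
    then show ?thesis
      using conrad_le_iff central_idempotent_join[OF h k] by blast
  qed
  ultimately show ?thesis
    unfolding is_sup_def using h_iff k_iff by blast
qed

end

theorem corollary3p6:
  fixes star :: "'a::ring \<Rightarrow> 'a"
  assumes "pq_baer_star_ring star"
  shows "pseudo_lattice (conrad_le :: 'a \<Rightarrow> 'a \<Rightarrow> bool)"
proof -
  interpret pq_baer_star_ring star by fact
  show ?thesis
    unfolding pseudo_lattice_def
    by (intro conjI allI impI reflpI antisympI transpI)
      (blast intro: conrad_le_refl conrad_le_antisym conrad_le_trans
        conrad_inf_exists conrad_sup_exists)+
qed

end
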